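(* Let $p$ be a fixed odd prime, let $q\in\mathbb{C}_p$ with $|q-1|_p<1$, and let the $q$-Euler numbers $\widetilde{E}_{n,q}$ ($n\ge 0$) be defined by $$\frac{[2]_q}{qe^{t}+1}=\sum_{n=0}^{\infty}\widetilde{E}_{n,q}\frac{t^n}{n!},\qquad [2]_q=1+q.$$ Then for every natural number $k\ge 1$, $$[2]_q\sum_{j=0}^{\lfloor k/2\rfloor}\binom{k}{2j}\frac{\widetilde{E}_{2k-2j+1,q}}{2k-2j+1}+(q-1)\sum_{j=0}^{\lfloor k/2\rfloor}\binom{k}{2j+1}\frac{\widetilde{E}_{2k-2j,q}}{2k-2j}=\frac{q(-1)^{k+1}}{(2k+1)\binom{2k}{k}}.$$
   Context: $\mathbb{C}_p$ is the completion of an algebraic closure of $\mathbb{Q}_p$, and $|\cdot|_p$ is the $p$-adic absolute value with $|p|_p=1/p$. The generating function is a formal power series in $t$. $\lfloor\cdot\rfloor$ is the floor (Gauss) symbol, and $\binom{k}{i}=0$ for $i>k$. *)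

theory Defs
  imports
    "HOL-Analysis.Analysis"
    "HOL-Algebra.Algebraic_Closure_Type"
    "HOL-Computational_Algebra.Computational_Algebra"
begin

definition padic_abs_rat :: "nat \<Rightarrow> rat \<Rightarrow> real" where
  "padic_abs_rat p r =
     (if r = 0 then 0
      else real p powi (int (multiplicity (int p) (snd (quotient_of r)))
                      - int (multiplicity (int p) (fst (quotient_of r)))))"

locale nonarch_absolute_value =
  fixes v :: "'a::field \<Rightarrow> real"
  assumes nonneg: "v x \<ge> 0"
    and eq_0_iff: "v x = 0 \<longleftrightarrow> x = 0"
    and mult: "v (x * y) = v x * v y"
    and ultrametric: "v (x + y) \<le> max (v x) (v y)"
begin

lemma v_1: "v 1 = 1"
  using mult[of 1 1] eq_0_iff[of 1] by simp

lemma v_minus: "v (- x) = v x"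
proof -
  have "v (- 1) * v (- 1) = 1"
    using mult[of "- 1" "- 1"] v_1 by simp
  hence "v (- 1) = 1"
    using nonneg[of "- 1"] by (metis abs_of_nonneg abs_one abs_mult_self_eq real_sqrt_abs2 real_sqrt_one)
  thus ?thesis
    using mult[of "- 1" x] by simp
qed

lemma metric: "Metric_space S (\<lambda>x y. v (x - y))"
proof
  fix x y z :: 'a
  show "v (x - y) = v (y - x)"
    using v_minus[of "x - y"] by simp
  show "v (x - z) \<le> v (x - y) + v (y - z)"
    using ultrametric[of "x - y" "y - z"] nonneg[of "x - y"] nonneg[of "y - z"] by auto
qed (auto simp: nonneg eq_0_iff)

end

text \<open>\<open>T\<close> is a completion of its subset \<open>S\<close> with respect to the metric \<open>v (x - y)\<close>.\<close>

definition is_completion :: "('a::field \<Rightarrow> real) \<Rightarrow> 'a set \<Rightarrow> 'a set \<Rightarrow> bool" where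
  "is_completion v S T \<longleftrightarrow>
     S \<subseteq> T \<and>
     Metric_space.mcomplete T (\<lambda>x y. v (x - y)) \<and>
     Metric_space.mtopology T (\<lambda>x y. v (x - y)) closure_of S = T"

definition is_algebraic_closure :: "'a::field set \<Rightarrow> 'a set \<Rightarrow> bool" where
  "is_algebraic_closure F A \<longleftrightarrow>
     algebraic_closure ((ring_of_type_algebra :: 'a ring)\<lparr>carrier := A\<rparr>) F"

text \<open>
  The type \<open>'a\<close> with the absolute value \<open>v\<close> is a model of \<open>\<complex>\<^sub>p\<close>, i.e. it is a completion of an
  algebraic closure \<open>A\<close> of a completion \<open>Qp\<close> of the rationals at \<open>p\<close>. Since \<open>\<complex>\<^sub>p\<close> depends on \<open>p\<close>,
  it is described as a structure on a type rather than as a fixed type. These conditions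
  determine the pair \<open>('a, v)\<close> up to isometric isomorphism.
\<close>

definition is_Cp :: "nat \<Rightarrow> ('a::field_char_0 \<Rightarrow> real) \<Rightarrow> bool" where
  "is_Cp p v \<longleftrightarrow>
     nonarch_absolute_value v \<and>
     (\<forall>r. v (of_rat r) = padic_abs_rat p r) \<and>
     (\<exists>Qp A. is_completion v (range of_rat) Qp \<and>
             is_algebraic_closure Qp A \<and>
             is_completion v A UNIV)"

definition q_Euler :: "nat \<Rightarrow> 'a::field_char_0 \<Rightarrow> 'a" where
  "q_Euler n q = fact n * fps_nth (fps_const (1 + q) / (fps_const q * fps_exp 1 + 1)) n"

lemma q_Euler_generating_function:
  "fps_const (1 + q) / (fps_const q * fps_exp 1 + 1) = Abs_fps (\<lambda>n. q_Euler n q / fact n)"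
  by (simp add: q_Euler_def fps_eq_iff)

lemma padic_abs_rat_prime:
  assumes "Factorial_Ring.prime p"
  shows "padic_abs_rat p (of_nat p) = 1 / real p"
proof -
  have "quotient_of (of_nat p :: rat) = (int p, 1)"
    by (simp add: of_nat_rat quotient_of_Fract Rat.normalize_def)
  moreover have "multiplicity (int p) (int p) = 1" "multiplicity (int p) 1 = 0"
    using assms by (auto intro!: multiplicity_self not_dvd_imp_multiplicity_0
        simp: prime_gt_0_nat not_prime_1 dest: prime_gt_1_nat)
  ultimately show ?thesis
    using assms by (auto simp: padic_abs_rat_def power_int_minus divide_simps dest: prime_gt_0_nat)
qed

end

theory Submission
  imports Defs
begin

text \<open>
  Let \<open>L\<close> be the linear functional on polynomials that sends \<open>x^n\<close> to \<open>q_Euler n q\<close>. The functional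
  equation of the generating function says \<open>q L(f(x + 1)) + L(f) = (1 + q) f(0)\<close>.
  The left-hand side of the theorem is \<open>L\<close> applied to the antiderivative, vanishing at \<open>0\<close>, of
  \<open>q y^k (y + 1)^k + y^k (y - 1)^k\<close>. If \<open>G\<close> is the antiderivative of \<open>y^k (y - 1)^k\<close> with
  \<open>G(0) = 0\<close>, this is \<open>q (G(x + 1) - G(1)) + G(x)\<close>, so its image under \<open>L\<close> is
  \<open>(1 + q) G(0) - q G(1) = - q G(1)\<close>, and \<open>G(1)\<close> is a Beta integral.

  Since \<open>p\<close> is odd, \<open>v (- 2) = 1\<close>, whence \<open>q \<noteq> - 1\<close> and the denominator \<open>q e^t + 1\<close> is a unit.
\<close>

hide_const (open) up_ring.coeff up_ring.monom Polynomials.degree module.smult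

section \<open>Linear functionals on polynomials with prescribed moments\<close>

definition moment_functional :: "(nat \<Rightarrow> 'a::comm_ring_1) \<Rightarrow> 'a poly \<Rightarrow> 'a" where
  "moment_functional m f = (\<Sum>i\<le>degree f. coeff f i * m i)"

text \<open>Coefficients above the degree vanish, so polynomials of different degrees can be summed
  over one common range.\<close>

lemma moment_functional_altdef:
  assumes "degree f \<le> N"
  shows "moment_functional m f = (\<Sum>i\<le>N. coeff f i * m i)"
  unfolding moment_functional_def
  by (rule sum.mono_neutral_left) (use assms in \<open>auto simp: coeff_eq_0\<close>)

lemma moment_functional_0 [simp]: "moment_functional m 0 = 0"
  by (simp add: moment_functional_def)

lemma moment_functional_add:
  "moment_functional m (f + g) = moment_functional m f + moment_functional m g"
proof -
  let ?N = "max (degree f) (degree g)"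
  have "degree (f + g) \<le> ?N" "degree f \<le> ?N" "degree g \<le> ?N"
    by (auto intro: degree_add_le)
  then show ?thesis
    by (simp add: moment_functional_altdef[of _ ?N] sum.distrib algebra_simps)
qed

lemma moment_functional_smult:
  "moment_functional m (smult c f) = c * moment_functional m f"
  by (simp add: moment_functional_altdef[of _ "degree f"] degree_smult_le sum_distrib_left mult.assoc)

lemma moment_functional_diff:
  "moment_functional m (f - g) = moment_functional m f - moment_functional m g"
  using moment_functional_add[of m f "smult (- 1) g"] moment_functional_smult[of m "- 1" g] by simp

lemma moment_functional_monom [simp]: "moment_functional m (monom c n) = c * m n"
proof -
  have "moment_functional m (monom c n) = (\<Sum>i\<le>n. if i = n then c * m i else 0)"
    unfolding moment_functional_altdef[OF degree_monom_le]
    by (rule sum.cong) auto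
  then show ?thesis
    by simp
qed

lemma moment_functional_const: "moment_functional m [:c:] = c * m 0"
  by (simp flip: monom_0)

lemma moment_functional_sum:
  "moment_functional m (\<Sum>i\<in>A. f i) = (\<Sum>i\<in>A. moment_functional m (f i))"
  by (induction A rule: infinite_finite_induct) (auto simp: moment_functional_add)

section \<open>The functional equation of the q-Euler moments under
  \<open>x \<mapsto> x + 1\<close>\<close>

lemma pcompose_power: "pcompose (f ^ n) g = pcompose f g ^ n"
  for f g :: "'a::comm_ring_1 poly"
  by (induction n) (auto simp: pcompose_mult pcompose_1)

lemma monom_pcompose_shift:
  "pcompose (monom c n) [:1, 1:] = (\<Sum>i\<le>n. monom (c * of_nat (n choose i)) i)"
    for c :: "'a::comm_ring_1"
proof -
  have "[:1, 1:] = monom 1 1 + (1 :: 'a poly)"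
    by (simp add: monom_altdef one_pCons)
  then have "[:1, 1:] ^ n = (\<Sum>i\<le>n. of_nat (n choose i) * monom (1::'a) i)"
    by (simp add: binomial_ring monom_power)
  also have "\<dots> = (\<Sum>i\<le>n. monom (of_nat (n choose i)) i)"
    by (simp add: of_nat_poly smult_monom)
  finally have pow: "[:1, 1:] ^ n = (\<Sum>i\<le>n. monom (of_nat (n choose i) :: 'a) i)" .
  have "pcompose (monom c n) [:1, 1:] = [:c:] * [:1, 1:] ^ n"
    by (simp add: monom_altdef pcompose_smult pcompose_power pcompose_pCons)
  also have "\<dots> = (\<Sum>i\<le>n. [:c:] * monom (of_nat (n choose i)) i)"
    by (simp only: pow sum_distrib_left)
  finally show ?thesis
    by (simp add: smult_monom)
qed

text \<open>Compares coefficients of \<open>t^n\<close> in \<open>F * (q e^t + 1) = 1 + q\<close>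
  and multiplies by \<open>n!\<close>.\<close>

lemma q_Euler_recurrence:
  fixes q :: "'a::field_char_0"
  assumes "q \<noteq> - 1"
  shows "q * (\<Sum>i\<le>n. of_nat (n choose i) * q_Euler i q) + q_Euler n q = (if n = 0 then 1 + q else 0)"
proof -
  define D where "D = fps_const q * fps_exp 1 + 1"
  define F where "F = Abs_fps (\<lambda>n. q_Euler n q / fact n)"
  \<comment> \<open>The constant term is \<open>1 + q\<close>; being nonzero it makes
    \<open>D\<close> a unit, so the division in \<open>q_Euler\<close> is exact.\<close>
  have "fps_nth D 0 \<noteq> 0"
    using assms by (simp add: D_def add_eq_0_iff2)
  then have "F * D = fps_const (1 + q)"
    unfolding F_def D_def q_Euler_generating_function[symmetric]
    by (simp add: unit_imp_dvd fps_is_unit_iff)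
  then have "fps_nth (fps_const q * (F * fps_exp 1) + F) n = fps_nth (fps_const (1 + q)) n"
    by (simp add: D_def algebra_simps)
  then have "fact n * (q * (\<Sum>i=0..n. q_Euler i q / fact i * (1 / fact (n - i))) + q_Euler n q / fact n)
      = fact n * (if n = 0 then 1 + q else 0)"
    by (simp only: fps_add_nth fps_mult_left_const_nth fps_mult_nth[of _ "fps_exp 1"] F_def fps_nth_Abs_fps
        fps_exp_nth power_one of_nat_fact fps_nth_fps_const)
  moreover have "fact n * (\<Sum>i=0..n. q_Euler i q / fact i * (1 / fact (n - i)))
      = (\<Sum>i\<le>n. of_nat (n choose i) * q_Euler i q)"
    unfolding sum_distrib_left atLeast0AtMost
    by (rule sum.cong) (auto simp: binomial_fact)
  ultimately show ?thesis
    by (cases "n = 0") (simp_all add: algebra_simps)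
qed

text \<open>Both sides are linear in \<open>f\<close>, and on \<open>monom c n\<close> the claim is
  \<open>c\<close> times the recurrence.\<close>

lemma q_Euler_functional_shift:
  fixes q :: "'a::field_char_0"
  defines "L \<equiv> moment_functional (\<lambda>n. q_Euler n q)"
  assumes "q \<noteq> - 1"
  shows "q * L (pcompose f [:1, 1:]) + L f = (1 + q) * coeff f 0"
proof -
  have monom: "q * L (pcompose (monom c n) [:1, 1:]) + L (monom c n) = (1 + q) * coeff (monom c n) 0"
    for c n
  proof -
    have "q * L (pcompose (monom c n) [:1, 1:]) + L (monom c n)
        = c * (q * (\<Sum>i\<le>n. of_nat (n choose i) * q_Euler i q) + q_Euler n q)"
      by (simp add: L_def monom_pcompose_shift moment_functional_sum sum_distrib_left algebra_simps)
    then show ?thesis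
      by (simp add: q_Euler_recurrence[OF assms(2)])
  qed
  define g where "g = (\<lambda>i. monom (coeff f i) i)"
  have f: "f = (\<Sum>i\<le>degree f. g i)"
    by (simp add: g_def poly_as_sum_of_monoms)
  \<comment> \<open>A free bound \<open>d\<close> separates the sum from \<open>degree f\<close>,
    where \<open>f\<close> occurs again.\<close>
  have "q * L (pcompose (\<Sum>i\<le>d. g i) [:1, 1:]) + L (\<Sum>i\<le>d. g i) = (1 + q) * coeff (\<Sum>i\<le>d. g i) 0" for d
    unfolding L_def g_def pcompose_sum moment_functional_sum coeff_sum sum_distrib_left
      sum.distrib[symmetric]
    by (rule sum.cong[OF refl monom[unfolded L_def]])
  then show ?thesis
    using f by metis
qed

section \<open>The antiderivative of \<open>x^k (x + a)^k\<close> and the Beta integral\<close>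

lemma pderiv_sum: "pderiv (\<Sum>i\<in>A. f i) = (\<Sum>i\<in>A. pderiv (f i))"
  by (induction A rule: infinite_finite_induct) (auto simp: pderiv_add)

lemma poly_eqI_pderiv:
  fixes f g :: "'a::field_char_0 poly"
  assumes "pderiv f = pderiv g" and "poly f a = poly g a"
  shows "f = g"
proof -
  have "pderiv (f - g) = 0"
    using assms(1) by (simp add: pderiv_diff)
  then obtain c where "f - g = [:c:]"
    by (metis pderiv_eq_0_iff degree_eq_zeroE)
  then show ?thesis
    using assms(2) by (metis eq_iff_diff_eq_0 mult_zero_right pCons_0_0 poly_0 poly_diff poly_pCons add.right_neutral)
qed

text \<open>The antiderivative of \<open>x^k (x + a)^k\<close> that vanishes at \<open>0\<close>.\<close>

definition beta_poly :: "nat \<Rightarrow> 'a::field_char_0 \<Rightarrow> 'a poly" where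
  "beta_poly k a =
     (\<Sum>i\<le>k. monom (of_nat (k choose i) * a ^ i / of_nat (2 * k - i + 1)) (2 * k - i + 1))"

lemma coeff_0_beta_poly: "coeff (beta_poly k a) 0 = 0"
  by (simp add: beta_poly_def coeff_sum)

lemma pderiv_beta_poly: "pderiv (beta_poly k a) = [:0, 1:] ^ k * [:a, 1:] ^ k"
proof -
  have "pderiv (beta_poly k a) = (\<Sum>i\<le>k. monom (of_nat (k choose i) * a ^ i) (2 * k - i))"
    unfolding beta_poly_def pderiv_sum
    by (rule sum.cong) (auto simp: pderiv_monom simp del: of_nat_Suc)
  also have "\<dots> = (\<Sum>i\<le>k. monom 1 k * (of_nat (k choose i) * [:a:] ^ i * monom 1 1 ^ (k - i)))"
  proof (rule sum.cong)
    fix i assume "i \<in> {..k}"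
    then have "2 * k - i = k + (k - i)" by simp
    then show "monom (of_nat (k choose i) * a ^ i) (2 * k - i)
        = monom 1 k * (of_nat (k choose i) * [:a:] ^ i * monom 1 1 ^ (k - i))"
      by (simp add: monom_power of_nat_poly smult_monom mult_monom poly_const_pow)
  qed simp
  also have "\<dots> = monom 1 k * ([:a:] + monom 1 1) ^ k"
    by (simp add: binomial_ring sum_distrib_left)
  finally show ?thesis
    by (simp add: monom_altdef)
qed

text \<open>Substituting \<open>x + 1\<close> into \<open>x^k (x - 1)^k\<close> gives
  \<open>(x + 1)^k x^k\<close>, so both sides have the same derivative; the subtracted constant
  makes both vanish at \<open>0\<close>.\<close>

lemma beta_poly_shift:
  "beta_poly k 1 = pcompose (beta_poly k (- 1)) [:1, 1:] - [:poly (beta_poly k (- 1)) 1:]"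
proof (rule poly_eqI_pderiv)
  show "pderiv (beta_poly k 1) =
      pderiv (pcompose (beta_poly k (- 1)) [:1, 1:] - [:poly (beta_poly k (- 1)) (1 :: 'a):])"
    by (simp add: pderiv_diff pderiv_pcompose pderiv_beta_poly pcompose_mult pcompose_power
        pcompose_pCons pderiv_pCons mult.commute)
  show "poly (beta_poly k 1) 0 =
      poly (pcompose (beta_poly k (- 1)) [:1, 1:] - [:poly (beta_poly k (- 1)) (1 :: 'a):]) 0"
    by (simp add: poly_pcompose poly_0_coeff_0 coeff_0_beta_poly)
qed

text \<open>The sum is the integral of \<open>x^m (1 - x)^k\<close> over \<open>[0, 1]\<close>. The
  induction mirrors \<open>(1 - x)^(k + 1) = (1 - x)^k - x (1 - x)^k\<close>, which on coefficients
  is Pascal's rule.\<close>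

lemma beta_alternating_sum:
  "(\<Sum>i\<le>k. of_nat (k choose i) * (- 1) ^ i / of_nat (m + i + 1))
     = (fact m * fact k / fact (m + k + 1) :: 'a::field_char_0)"
proof (induction k arbitrary: m)
  case 0
  show ?case by (simp add: divide_simps del: of_nat_Suc)
next
  case (Suc k)
  define B where "B = (\<lambda>k m. \<Sum>i\<le>k. of_nat (k choose i) * (- 1) ^ i / (of_nat (m + i + 1) :: 'a))"
  have "B (Suc k) m = B k m - B k (Suc m)"
  proof -
    \<comment> \<open>The added term is zero since \<open>k choose Suc k = 0\<close>; now the ranges
      agree and Pascal's rule applies termwise.\<close>
    have "B k m = (\<Sum>i\<le>Suc k. of_nat (k choose i) * (- 1) ^ i / of_nat (m + i + 1))"
      by (simp add: B_def)
    also have "\<dots> = 1 / of_nat (m + 1)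
        + (\<Sum>i\<le>k. of_nat (k choose Suc i) * (- 1) ^ Suc i / of_nat (m + Suc i + 1))"
      by (subst sum.atMost_Suc_shift) simp
    finally have Bk: "B k m = \<dots>" .
    have "B (Suc k) m = 1 / of_nat (m + 1)
        + (\<Sum>i\<le>k. of_nat (Suc k choose Suc i) * (- 1) ^ Suc i / of_nat (m + Suc i + 1))"
      unfolding B_def by (subst sum.atMost_Suc_shift) simp
    also have "(\<Sum>i\<le>k. of_nat (Suc k choose Suc i) * (- 1) ^ Suc i / of_nat (m + Suc i + 1)) =
        (\<Sum>i\<le>k. of_nat (k choose Suc i) * (- 1) ^ Suc i / of_nat (m + Suc i + 1)) - B k (Suc m)"
      unfolding B_def sum_subtractf[symmetric]
      by (rule sum.cong) (auto simp: add_divide_distrib diff_divide_distrib algebra_simps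
          simp del: of_nat_Suc)
    finally show ?thesis
      by (simp add: Bk)
  qed
  also have "\<dots> = fact m * fact k / fact (m + k + 1) - fact (Suc m) * fact k / fact (Suc m + k + 1)"
    using Suc.IH[of m] Suc.IH[of "Suc m"] by (simp only: B_def)
  also have "\<dots> = fact m * fact (Suc k) / fact (m + Suc k + 1)"
  proof -
    have "fact (m + k + 2) = of_nat (m + k + 2) * (fact (m + k + 1) :: 'a)"
      by (metis add_2_eq_Suc' fact_Suc Suc_eq_plus1 add_Suc_right)
    moreover have "of_nat (m + k + 2) \<noteq> (0 :: 'a)" "fact (m + k + 1) \<noteq> (0 :: 'a)"
      by (simp_all only: of_nat_eq_0_iff fact_nonzero) simp_all
    ultimately show ?thesis
      by (simp add: divide_simps del: fact_Suc) (simp add: algebra_simps)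
  qed
  finally show ?case
    by (simp only: B_def)
qed

lemma poly_beta_poly_1:
  "poly (beta_poly k (- 1)) 1
     = (- 1) ^ k / (of_nat (2 * k + 1) * of_nat ((2 * k) choose k) :: 'a::field_char_0)"
proof -
  have "poly (beta_poly k (- 1)) (1 :: 'a)
      = (\<Sum>i\<le>k. of_nat (k choose i) * (- 1) ^ i / of_nat (2 * k - i + 1))"
    by (simp add: beta_poly_def poly_sum poly_monom)
  \<comment> \<open>Reversing the order turns the denominators into \<open>k + i + 1\<close>, the
    case \<open>m = k\<close> of the alternating sum.\<close>
  also have "\<dots> = (\<Sum>i\<le>k. of_nat (k choose (k - i)) * (- 1) ^ (k - i) / of_nat (2 * k - (k - i) + 1))"
    by (rule sum.nat_diff_reindex[symmetric, of _ "Suc k", simplified lessThan_Suc_atMost, simplified])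
  also have "\<dots> = (\<Sum>i\<le>k. (- 1) ^ k * (of_nat (k choose i) * (- 1) ^ i / of_nat (k + i + 1)))"
  proof (rule sum.cong)
    fix i assume "i \<in> {..k}"
    then have "k choose (k - i) = k choose i" "2 * k - (k - i) = k + i"
        "(- 1) ^ (k - i) = ((- 1) ^ k * (- 1) ^ i :: 'a)"
      by (auto simp: binomial_symmetric[symmetric] uminus_power_if)
    then show "of_nat (k choose (k - i)) * (- 1) ^ (k - i) / of_nat (2 * k - (k - i) + 1)
        = (- 1) ^ k * (of_nat (k choose i) * (- 1) ^ i / of_nat (k + i + 1) :: 'a)"
      by (simp del: of_nat_Suc)
  qed simp
  also have "\<dots> = (- 1) ^ k * (fact k * fact k / fact (k + k + 1))"
    by (simp only: beta_alternating_sum flip: sum_distrib_left)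
  also have "(fact k * fact k / fact (k + k + 1) :: 'a) = 1 / (of_nat (2 * k + 1) * of_nat ((2 * k) choose k))"
    by (simp add: binomial_fact mult_2 del: of_nat_Suc of_nat_add)
  finally show ?thesis
    by simp
qed

section \<open>Evaluation of the functional and comparison with the stated sums\<close>

lemma q_Euler_beta_poly:
  fixes q :: "'a::field_char_0"
  defines "L \<equiv> moment_functional (\<lambda>n. q_Euler n q)"
  assumes "q \<noteq> - 1"
  shows "q * L (beta_poly k 1) + L (beta_poly k (- 1))
    = q * (- 1) ^ (k + 1) / (of_nat (2 * k + 1) * of_nat ((2 * k) choose k))"
proof -
  let ?G = "beta_poly k (- 1) :: 'a poly"
  \<comment> \<open>Hence \<open>L\<close> fixes constants, and the constant in
    \<open>beta_poly_shift\<close> contributes exactly \<open>- q * poly ?G 1\<close>.\<close>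
  have "q_Euler 0 q = 1"
    using q_Euler_recurrence[OF assms(2), of 0] assms(2)
    by (simp add: add_eq_0_iff2 q_Euler_def)
  then have "q * L (beta_poly k 1) + L ?G = (q * L (pcompose ?G [:1, 1:]) + L ?G) - q * poly ?G 1"
    by (simp add: beta_poly_shift L_def moment_functional_diff moment_functional_const algebra_simps)
  also have "\<dots> = - q * poly ?G 1"
    unfolding L_def q_Euler_functional_shift[OF assms(2)] by (simp add: coeff_0_beta_poly)
  finally show ?thesis
    by (simp add: poly_beta_poly_1)
qed

lemma sum_atMost_even_odd: "(\<Sum>i\<le>2 * n + 1. f i) = (\<Sum>j\<le>n. f (2 * j)) + (\<Sum>j\<le>n. f (2 * j + 1))"
  for f :: "nat \<Rightarrow> 'a::comm_monoid_add"
  by (induction n) (auto simp: ac_simps)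

text \<open>An odd prime does not divide 2. The argument is \<open>- 2\<close> because this is the
  value of \<open>q - 1\<close> at \<open>q = - 1\<close>.\<close>

lemma is_Cp_v_2:
  fixes v :: "'a::field_char_0 \<Rightarrow> real"
  assumes "Factorial_Ring.prime p" and "odd p" and "is_Cp p v"
  shows "v (- 2) = 1"
proof -
  have "\<not> int p dvd 2"
    using assms(1,2) by (metis dvd_def even_numeral int_dvd_int_iff not_prime_1 of_nat_numeral
        prime_nat_iff two_is_prime_nat)
  then have "multiplicity (int p) 2 = 0" "multiplicity (int p) 1 = 0"
    by (auto intro: not_dvd_imp_multiplicity_0)
  moreover have "quotient_of (2 :: rat) = (2, 1)"
    by (simp add: quotient_of_number)
  ultimately have "padic_abs_rat p 2 = 1"
    by (simp add: padic_abs_rat_def)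
  moreover have "v (of_rat 2) = padic_abs_rat p 2" and "nonarch_absolute_value v"
    using assms(3) unfolding is_Cp_def by blast+
  ultimately show ?thesis
    by (simp add: nonarch_absolute_value.v_minus)
qed

theorem theorem2:
  fixes p k :: nat
    and v :: "'a::field_char_0 \<Rightarrow> real"
    and q :: 'a
  assumes "Factorial_Ring.prime p" and "odd p"
    and "is_Cp p v"
    and "v (q - 1) < 1"
    and "k \<ge> 1"
  shows "(1 + q) * (\<Sum>j = 0..k div 2. of_nat (k choose (2 * j)) *
             (q_Euler (2 * k - 2 * j + 1) q / of_nat (2 * k - 2 * j + 1)))
       + (q - 1) * (\<Sum>j = 0..k div 2. of_nat (k choose (2 * j + 1)) *
             (q_Euler (2 * k - 2 * j) q / of_nat (2 * k - 2 * j)))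
       = q * (- 1) ^ (k + 1) / (of_nat (2 * k + 1) * of_nat ((2 * k) choose k))"
proof -
  have q: "q \<noteq> - 1"
    using is_Cp_v_2[OF assms(1-3)] assms(4) by auto
  define L where "L = moment_functional (\<lambda>n. q_Euler n q)"
  \<comment> \<open>The factor \<open>q + (- 1) ^ i\<close> is \<open>1 + q\<close> for even
    \<open>i\<close> and \<open>q - 1\<close> for odd \<open>i\<close>, so splitting by parity
    yields the two sums.\<close>
  define T where "T = (\<lambda>i. of_nat (k choose i) * (q + (- 1) ^ i) *
      (q_Euler (2 * k - i + 1) q / of_nat (2 * k - i + 1)))"
  have L_beta: "L (beta_poly k a) = (\<Sum>i\<le>k. of_nat (k choose i) * a ^ i *
      (q_Euler (2 * k - i + 1) q / of_nat (2 * k - i + 1)))" for a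
    by (simp add: L_def beta_poly_def moment_functional_sum)
  have "q * L (beta_poly k 1) + L (beta_poly k (- 1)) = (\<Sum>i\<le>k. T i)"
    unfolding L_beta T_def sum_distrib_left sum.distrib[symmetric]
    by (rule sum.cong) (auto simp: algebra_simps add_divide_distrib simp del: of_nat_Suc)
  \<comment> \<open>The new bound is \<open>k\<close> or \<open>k + 1\<close>; in the latter case
    the extra binomial coefficient is zero.\<close>
  also have "\<dots> = (\<Sum>i\<le>2 * (k div 2) + 1. T i)"
    by (rule sum.mono_neutral_left) (auto simp: T_def)
  also have "\<dots> = (\<Sum>j\<le>k div 2. T (2 * j)) + (\<Sum>j\<le>k div 2. T (2 * j + 1))"
    by (rule sum_atMost_even_odd)
  also have "(\<Sum>j\<le>k div 2. T (2 * j)) = (1 + q) * (\<Sum>j = 0..k div 2. of_nat (k choose (2 * j)) *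
             (q_Euler (2 * k - 2 * j + 1) q / of_nat (2 * k - 2 * j + 1)))"
    by (simp add: T_def sum_distrib_left atLeast0AtMost mult.commute mult.left_commute add.commute del: of_nat_Suc)
  also have "(\<Sum>j\<le>k div 2. T (2 * j + 1)) = (q - 1) * (\<Sum>j = 0..k div 2. of_nat (k choose (2 * j + 1)) *
             (q_Euler (2 * k - 2 * j) q / of_nat (2 * k - 2 * j)))"
    unfolding sum_distrib_left atLeast0AtMost
  proof (rule sum.cong)
    fix j assume "j \<in> {..k div 2}"
    \<comment> \<open>Truncated subtraction is harmless: \<open>2 * j \<le> k\<close> and
      \<open>k \<ge> 1\<close> give \<open>2 * j + 1 \<le> 2 * k\<close>.\<close>
    then have "2 * k - (2 * j + 1) + 1 = 2 * k - 2 * j"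
      using assms(5) by auto
    then show "T (2 * j + 1) = (q - 1) * (of_nat (k choose (2 * j + 1)) *
             (q_Euler (2 * k - 2 * j) q / of_nat (2 * k - 2 * j)))"
      unfolding T_def by (simp only:) simp
  qed simp
  finally show ?thesis
    using q_Euler_beta_poly[OF q, of k] by (simp add: L_def)
qed

end
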